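(* Let $k\ge 1$ be an integer. If a digraph $D$ is $2k$-arc-antistrong, then $D$ contains $k$ pairwise arc-disjoint spanning subdigraphs, each of which is antistrong.
   Context: Digraphs are finite and loopless. In a walk (in the underlying graph) an arc $vw$ is forward if traversed from $v$ to $w$ and backward if traversed from $w$ to $v$. An antidirected trail is a walk with no repeated arc whose arcs alternate between forward and backward; it is a forward antidirected trail if it begins and ends with a forward arc. A digraph is antistrong if it has at least three vertices and contains a forward antidirected $(x,y)$-trail for every pair of distinct vertices $x,y$. A digraph is $k$-arc-antistrong if it has at least three vertices and contains $k$ pairwise arc-disjoint forward antidirected $(x,y)$-trails for all distinct vertices $x,y$. *)

theory Defs
  imports "Graph_Theory.Digraph_Component" "HOL-Library.Disjoint_Sets"
begin

datatype direction = Forward | Backward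

text \<open>
  A walk in the underlying graph is given by its start vertex and the list of its arcs, each with
  the direction in which it is traversed. Vertices may repeat.
\<close>

type_synonym 'b steps = "('b \<times> direction) list"

definition step_from :: "('a, 'b) pre_digraph \<Rightarrow> 'b \<times> direction \<Rightarrow> 'a" where
  "step_from G s = (case snd s of Forward \<Rightarrow> tail G (fst s) | Backward \<Rightarrow> head G (fst s))"

definition step_to :: "('a, 'b) pre_digraph \<Rightarrow> 'b \<times> direction \<Rightarrow> 'a" where
  "step_to G s = (case snd s of Forward \<Rightarrow> head G (fst s) | Backward \<Rightarrow> tail G (fst s))"

fun underlying_walk :: "('a, 'b) pre_digraph \<Rightarrow> 'a \<Rightarrow> 'b steps \<Rightarrow> 'a \<Rightarrow> bool" where
  "underlying_walk G x [] y \<longleftrightarrow> x \<in> verts G \<and> x = y"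
| "underlying_walk G x (s # p) y \<longleftrightarrow>
     fst s \<in> arcs G \<and> step_from G s = x \<and> underlying_walk G (step_to G s) p y"

definition steps_arcs :: "'b steps \<Rightarrow> 'b set" where
  "steps_arcs p = fst ` set p"

definition antidirected_trail :: "('a, 'b) pre_digraph \<Rightarrow> 'a \<Rightarrow> 'b steps \<Rightarrow> 'a \<Rightarrow> bool" where
  "antidirected_trail G x p y \<longleftrightarrow>
     underlying_walk G x p y \<and> distinct (map fst p) \<and> successively (\<noteq>) (map snd p)"

definition forward_antidirected_trail :: "('a, 'b) pre_digraph \<Rightarrow> 'a \<Rightarrow> 'b steps \<Rightarrow> 'a \<Rightarrow> bool" where
  "forward_antidirected_trail G x p y \<longleftrightarrow>
     antidirected_trail G x p y \<and> p \<noteq> [] \<and> snd (hd p) = Forward \<and> snd (last p) = Forward"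

text \<open>
  The next two definitions are meant for finite digraphs: \<open>card\<close> of an infinite set is \<open>0\<close>.
\<close>

definition antistrong :: "('a, 'b) pre_digraph \<Rightarrow> bool" where
  "antistrong G \<longleftrightarrow> card (verts G) \<ge> 3 \<and>
     (\<forall>x \<in> verts G. \<forall>y \<in> verts G. x \<noteq> y \<longrightarrow> (\<exists>p. forward_antidirected_trail G x p y))"

definition arc_antistrong :: "nat \<Rightarrow> ('a, 'b) pre_digraph \<Rightarrow> bool" where
  "arc_antistrong k G \<longleftrightarrow> card (verts G) \<ge> 3 \<and>
     (\<forall>x \<in> verts G. \<forall>y \<in> verts G. x \<noteq> y \<longrightarrow>
       (\<exists>P :: nat \<Rightarrow> 'b steps. (\<forall>i<k. forward_antidirected_trail G x (P i) y) \<and>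
          disjoint_family_on (\<lambda>i. steps_arcs (P i)) {..<k}))"

text \<open>Finite and loopless; parallel arcs are allowed.\<close>

locale fin_loopfree_digraph = fin_digraph + loopfree_digraph

end

theory Submission
  imports Defs
begin

text \<open>
  Split every vertex \<open>v\<close> of \<open>D\<close> into an out-copy \<open>Inl v\<close> and an in-copy \<open>Inr v\<close>, and let an arc \<open>vw\<close>
  join \<open>Inl v\<close> to \<open>Inr w\<close>. Forward antidirected \<open>(x, y)\<close>-trails of \<open>D\<close> are the trails from \<open>Inl x\<close> to
  \<open>Inr y\<close> of this bipartite graph. With at least three vertices, every cut of the bipartite graph
  separates some \<open>Inl x\<close> from some \<open>Inr y\<close> with \<open>x \<noteq> y\<close>, so \<open>2k\<close>-arc-antistrength makes it
  \<open>2k\<close>-edge-connected. By the tree packing theorem of Tutte and Nash-Williams it has \<open>k\<close> disjoint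
  connected spanning subgraphs, and these are antistrong as subdigraphs of \<open>D\<close>.

  For the tree packing theorem, start from a maximum packing \<open>F\<close> of \<open>k\<close> forests and let \<open>R\<close> be the set
  of all edges left uncovered by some packing that is reachable from \<open>F\<close> by single-edge exchanges.
  Exchanges happen inside \<open>R\<close> and do not change what \<open>F i \<inter> R\<close> connects, so that every \<open>F i \<inter> R\<close>
  connects as much as \<open>R\<close> itself. Counting the edges outside \<open>R\<close>, which are all covered, against the
  partition into the components of \<open>R\<close> shows that every \<open>F i\<close> is a spanning tree.
\<close>

section \<open>Connectedness and forests in multigraphs\<close>

text \<open>
  A multigraph is an edge set \<open>E\<close> with a map \<open>f\<close> sending each edge to its two ends, in arbitrary order.
  As \<open>conn f X\<close> is reflexive on the whole vertex type, \<open>V // conn f X\<close> is the set of components of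
  \<open>(V, X)\<close>, isolated vertices included.
\<close>

definition conn :: "('e \<Rightarrow> 'v \<times> 'v) \<Rightarrow> 'e set \<Rightarrow> ('v \<times> 'v) set" where
  "conn f X = (f ` X \<union> (f ` X)\<inverse>)\<^sup>*"

lemma equiv_conn: "equiv UNIV (conn f X)"
  unfolding conn_def
  by (intro equivI refl_rtrancl sym_rtrancl trans_rtrancl sym_Un_converse) auto

lemma conn_refl [simp, intro]: "(u, u) \<in> conn f X"
  by (simp add: conn_def)

lemma conn_superset: "e \<in> X \<Longrightarrow> f e \<in> conn f X"
  by (auto simp: conn_def)

lemma conn_least:
  assumes "equiv UNIV r" "f ` X \<subseteq> r"
  shows "conn f X \<subseteq> r"
proof (rule subrelI)
  fix u v assume "(u, v) \<in> conn f X"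
  then show "(u, v) \<in> r"
    unfolding conn_def
  proof (induction rule: rtrancl_induct)
    case base
    show ?case
      using assms(1) by (simp add: equiv_def refl_on_def)
  next
    case (step v w)
    then have "(v, w) \<in> r \<or> (w, v) \<in> r"
      using assms(2) by blast
    then show ?case
      using step.IH assms(1) by (meson equivE symD transD)
  qed
qed

lemma conn_subset_conn: "f ` X \<subseteq> conn f Y \<Longrightarrow> conn f X \<subseteq> conn f Y"
  by (intro conn_least equiv_conn)

lemma conn_mono: "X \<subseteq> Y \<Longrightarrow> conn f X \<subseteq> conn f Y"
  by (intro conn_subset_conn image_subsetI conn_superset) blast

lemma conn_iff_class: "(u, v) \<in> conn f X \<longleftrightarrow> conn f X `` {u} = conn f X `` {v}"
  using eq_equiv_class_iff[OF equiv_conn, of u v f X] by simp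

lemma conn_insert_iff:
  assumes "f e = (a, b)"
  shows "(u, v) \<in> conn f (insert e X) \<longleftrightarrow>
    (u, v) \<in> conn f X \<or> (u, a) \<in> conn f X \<and> (b, v) \<in> conn f X \<or>
    (u, b) \<in> conn f X \<and> (a, v) \<in> conn f X"
proof -
  \<comment> \<open>Class labels turn statements about \<open>conn\<close> into equalities, ready
    for plain equality reasoning.\<close>
  define c where "c = (\<lambda>v. conn f X `` {v})"
  have c: "(u, v) \<in> conn f X \<longleftrightarrow> c u = c v" for u v
    by (simp add: c_def flip: conn_iff_class)
  define d where "d = (\<lambda>v. conn f (insert e X) `` {v})"
  have d: "(u, v) \<in> conn f (insert e X) \<longleftrightarrow> d u = d v" for u v
    by (simp add: d_def flip: conn_iff_class)
  \<comment> \<open>\<open>r\<close> fuses the classes of \<open>a\<close> and \<open>b\<close>.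
    Leastness of \<open>conn\<close> gives one inclusion, monotonicity and the edge \<open>e\<close>
    the other.\<close>
  define r where "r = {(u, v). c u = c v \<or> c u = c a \<and> c b = c v \<or> c u = c b \<and> c a = c v}"
  have "conn f (insert e X) \<subseteq> r"
  proof (rule conn_least)
    show "equiv UNIV r"
      by (rule equivI) (auto simp: r_def refl_on_def sym_def trans_def)
    have "f ` X \<subseteq> r"
      using conn_superset[of _ X f] c by (force simp: r_def)
    then show "f ` insert e X \<subseteq> r"
      using assms by (simp add: r_def)
  qed
  then have "(u, v) \<in> r" if "d u = d v"
    using that d by blast
  moreover have "d u = d v" if "c u = c v" for u v
    using that c d conn_mono[OF subset_insertI, of f X e] by blast
  moreover have "d a = d b"
    using conn_superset[of e "insert e X" f] assms d by simp
  ultimately show ?thesis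
    unfolding c d r_def mem_Collect_eq prod.case by metis
qed

text \<open>Exchange property of the cycle matroid: if \<open>e'\<close> is what completes a
  connection between the ends of \<open>e\<close>, then its own ends are joined by going round
  through \<open>e\<close>.\<close>

lemma conn_exchange:
  assumes "f e \<in> conn f (insert e' X)" "f e \<notin> conn f X"
  shows "f e' \<in> conn f (insert e X)"
proof -
  obtain a b where e: "f e = (a, b)" by fastforce
  obtain a' b' where e': "f e' = (a', b')" by fastforce
  define c where "c = (\<lambda>v. conn f X `` {v})"
  have c: "(u, v) \<in> conn f X \<longleftrightarrow> c u = c v" for u v
    by (simp add: c_def flip: conn_iff_class)
  show ?thesis
    using assms unfolding e e' conn_insert_iff[of f e, OF e] conn_insert_iff[of f e', OF e'] c by auto
qed

text \<open>Independence in the cycle matroid; a loop or a pair of parallel edges is already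
  dependent.\<close>

definition edge_forest :: "('e \<Rightarrow> 'v \<times> 'v) \<Rightarrow> 'e set \<Rightarrow> bool" where
  "edge_forest f X \<longleftrightarrow> (\<forall>e \<in> X. f e \<notin> conn f (X - {e}))"

lemma edge_forest_subset: "edge_forest f X \<Longrightarrow> Y \<subseteq> X \<Longrightarrow> edge_forest f Y"
  unfolding edge_forest_def using conn_mono[OF Diff_mono[OF _ order_refl], of Y X f] by blast

text \<open>If an old edge \<open>e'\<close> became dependent, exchange would join the ends of
  \<open>e\<close> within \<open>X\<close>.\<close>

lemma edge_forest_insert:
  assumes "edge_forest f X" "f e \<notin> conn f X"
  shows "edge_forest f (insert e X)"
  unfolding edge_forest_def
proof (intro ballI notI)
  fix e' assume e': "e' \<in> insert e X" "f e' \<in> conn f (insert e X - {e'})"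
  show False
  proof (cases "e' = e")
    case True
    then have "conn f (insert e X - {e'}) \<subseteq> conn f X"
      by (intro conn_mono) auto
    then show False
      using e' True assms by auto
  next
    case False
    then have "e' \<in> X" and *: "insert e X - {e'} = insert e (X - {e'})" "insert e' (X - {e'}) = X"
      using e' by auto
    then have "f e' \<notin> conn f (X - {e'})"
      using assms by (auto simp: edge_forest_def)
    then show False
      using conn_exchange[of f e' e "X - {e'}"] e' * assms by auto
  qed
qed

text \<open>
  The set on the right is the fundamental circuit of \<open>e\<close> (without \<open>e\<close>): a minimal subset of \<open>X\<close>
  connecting the ends of \<open>e\<close> is contained in it.
\<close>

lemma edge_forest_circuit:
  assumes "edge_forest f X" "finite X" "f e \<in> conn f X"
  shows "f e \<in> conn f {e' \<in> X. f e \<notin> conn f (X - {e'})}"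
proof -
  define P where "P Y \<longleftrightarrow> Y \<subseteq> X \<and> f e \<in> conn f Y" for Y
  have "P X"
    using assms by (simp add: P_def)
  then obtain Y where "P Y" and min: "\<And>Z. P Z \<Longrightarrow> card Y \<le> card Z"
    using ex_has_least_nat[of P X card] by blast
  then have Y: "Y \<subseteq> X" "f e \<in> conn f Y"
    by (simp_all add: P_def)
  \<comment> \<open>Otherwise minimality of \<open>Y\<close> and exchange make \<open>e'\<close>
    spanned by \<open>e\<close> and the rest of \<open>Y\<close>, hence by \<open>X - {e'}\<close>,
    against the forest property.\<close>
  have "f e \<notin> conn f (X - {e'})" if e': "e' \<in> Y" for e'
  proof
    assume *: "f e \<in> conn f (X - {e'})"
    have "card (Y - {e'}) < card Y"
      using e' finite_subset[OF Y(1) assms(2)] by (intro card_Diff1_less)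
    then have "\<not> P (Y - {e'})"
      using min[of "Y - {e'}"] by auto
    then have "f e \<notin> conn f (Y - {e'})"
      using Y by (auto simp: P_def)
    then have "f e' \<in> conn f (insert e (Y - {e'}))"
      using conn_exchange[of f e e' "Y - {e'}"] e' Y by (simp add: insert_absorb)
    moreover have "conn f (insert e (Y - {e'})) \<subseteq> conn f (X - {e'})"
    proof (intro conn_subset_conn image_subsetI)
      fix d assume "d \<in> insert e (Y - {e'})"
      then show "f d \<in> conn f (X - {e'})"
        using Y * conn_superset[of d "X - {e'}" f] by auto
    qed
    ultimately show False
      using e' Y assms(1) by (auto simp: edge_forest_def)
  qed
  then have "conn f Y \<subseteq> conn f {e' \<in> X. f e \<notin> conn f (X - {e'})}"
    using Y by (intro conn_mono) auto
  then show ?thesis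
    using Y by blast
qed

text \<open>The classes of the two ends, distinct by assumption, fuse; every other class is
  unchanged.\<close>

lemma card_quotient_insert:
  assumes "f e \<notin> conn f X" "f e \<in> V \<times> V" "finite V"
  shows "card (V // conn f (insert e X)) + 1 = card (V // conn f X)"
proof -
  obtain a b where e: "f e = (a, b)" by fastforce
  define r where "r = conn f X"
  define c where "c = (\<lambda>v. r `` {v})"
  have c: "(u, v) \<in> r \<longleftrightarrow> c u = c v" for u v
    by (simp add: c_def r_def flip: conn_iff_class)
  have ab: "a \<in> V" "b \<in> V" "c a \<noteq> c b"
    using assms e c by (auto simp: r_def)
  let ?r' = "conn f (insert e X)"
  have cls: "?r' `` {v} = (if v \<in> r `` {a} \<union> r `` {b} then r `` {a} \<union> r `` {b} else r `` {v})" for v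
    by (rule set_eqI) (auto simp: conn_insert_iff[of f e, OF e] r_def[symmetric] c)
  have eq: "r `` {u} = r `` {v} \<longleftrightarrow> c u = c v" for u v
    by (auto simp: c set_eq_iff)
  have ne: "r `` {a} \<noteq> r `` {b}"
    using ab eq by blast
  let ?Q = "V // r - {r `` {a}, r `` {b}}"
  have mem: "r `` {v} \<in> ?Q \<longleftrightarrow> v \<notin> r `` {a} \<union> r `` {b}" if "v \<in> V" for v
    using quotientI[OF that, of r] by (auto simp: eq c)
  have "V // ?r' = insert (r `` {a} \<union> r `` {b}) ?Q"
  proof (intro equalityI subsetI)
    fix C assume "C \<in> V // ?r'"
    then obtain v where v: "v \<in> V" "C = ?r' `` {v}"
      by (auto simp: quotient_def)
    show "C \<in> insert (r `` {a} \<union> r `` {b}) ?Q"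
      using v mem[of v] unfolding v(2) cls by auto
  next
    fix C assume C: "C \<in> insert (r `` {a} \<union> r `` {b}) ?Q"
    show "C \<in> V // ?r'"
    proof (cases "C = r `` {a} \<union> r `` {b}")
      case True
      have "?r' `` {a} = C"
        unfolding cls True by (simp add: c)
      then show ?thesis
        using ab by (auto simp: quotient_def)
    next
      case False
      then obtain v where v: "v \<in> V" "C = r `` {v}" "r `` {v} \<in> ?Q"
        using C by (auto simp: quotient_def)
      then have "?r' `` {v} = C"
        using mem[of v] unfolding cls by auto
      then show ?thesis
        using v by (auto simp: quotient_def)
    qed
  qed
  moreover have "r `` {a} \<union> r `` {b} \<notin> ?Q"
  proof
    assume "r `` {a} \<union> r `` {b} \<in> ?Q"
    then obtain v where "v \<in> V" "r `` {a} \<union> r `` {b} = r `` {v}" "v \<notin> r `` {a} \<union> r `` {b}"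
      using mem by (auto simp: quotient_def)
    moreover have "v \<in> r `` {v}"
      by (simp add: c)
    ultimately show False by blast
  qed
  moreover have fin: "finite (V // r)"
    using assms(3) by (auto simp: quotient_def)
  ultimately have "card (V // ?r') = card ?Q + 1"
    by simp
  moreover have "card ?Q + 2 = card (V // r)"
  proof -
    have sub: "{r `` {a}, r `` {b}} \<subseteq> V // r"
      using ab by (auto simp: quotient_def)
    have "card ?Q = card (V // r) - card {r `` {a}, r `` {b}}"
      using sub by (intro card_Diff_subset) auto
    moreover have "card {r `` {a}, r `` {b}} \<le> card (V // r)"
      using fin sub by (rule card_mono)
    moreover have "card {r `` {a}, r `` {b}} = 2"
      using ne by simp
    ultimately show ?thesis
      by simp
  qed
  ultimately show ?thesis
    by (simp add: r_def)
qed

text \<open>Starting from singleton components, each edge of the forest merges two of them.\<close>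

lemma card_forest:
  assumes "finite X" "edge_forest f X" "f ` X \<subseteq> V \<times> V" "finite V"
  shows "card (V // conn f X) + card X = card V"
  using assms
proof (induction X rule: finite_induct)
  case empty
  have "V // conn f {} = (\<lambda>v. {v}) ` V"
    by (auto simp: conn_def quotient_def)
  then show ?case
    by (simp add: card_image)
next
  case (insert e X)
  then have "f e \<notin> conn f X"
    by (auto simp: edge_forest_def)
  then show ?case
    using insert card_quotient_insert[of f e X V]
      edge_forest_subset[of f "insert e X" X, OF _ subset_insertI]
    by auto
qed

section \<open>Packing spanning trees\<close>

definition forest_packing ::
  "('e \<Rightarrow> 'v \<times> 'v) \<Rightarrow> 'e set \<Rightarrow> nat \<Rightarrow> (nat \<Rightarrow> 'e set) \<Rightarrow> bool" where
  "forest_packing f E k F \<longleftrightarrow>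
     (\<forall>i<k. F i \<subseteq> E \<and> edge_forest f (F i)) \<and> disjoint_family_on F {..<k}"

lemma ex_maximum_forest_packing:
  assumes "finite E"
  shows "\<exists>F. forest_packing f E k F \<and>
    (\<forall>F'. forest_packing f E k F' \<longrightarrow> card (\<Union>i<k. F' i) \<le> card (\<Union>i<k. F i))"
proof -
  have "forest_packing f E k (\<lambda>_. {})"
    by (simp add: forest_packing_def edge_forest_def disjoint_family_on_def)
  moreover have "\<forall>F. forest_packing f E k F \<longrightarrow> card (\<Union>i<k. F i) < Suc (card E)"
    using assms by (auto simp: forest_packing_def less_Suc_eq_le intro!: card_mono)
  ultimately show ?thesis
    by (rule ex_has_greatest_nat)
qed

text \<open>The two conditions on \<open>f e\<close> say that \<open>e'\<close> lies on the circuit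
  closed by \<open>e\<close> in \<open>F i\<close>. Trading \<open>e'\<close> for \<open>e\<close>
  therefore keeps a forest and the number of covered edges.\<close>

inductive exchange_reachable ::
  "('e \<Rightarrow> 'v \<times> 'v) \<Rightarrow> 'e set \<Rightarrow> nat \<Rightarrow> (nat \<Rightarrow> 'e set) \<Rightarrow> (nat \<Rightarrow> 'e set) \<Rightarrow> bool"
  for f E k F\<^sub>0 where
  base: "exchange_reachable f E k F\<^sub>0 F\<^sub>0"
| step: "exchange_reachable f E k F\<^sub>0 F \<Longrightarrow> i < k \<Longrightarrow> e \<in> E - (\<Union>j<k. F j) \<Longrightarrow>
    e' \<in> F i \<Longrightarrow> f e \<in> conn f (F i) \<Longrightarrow> f e \<notin> conn f (F i - {e'}) \<Longrightarrow>
    exchange_reachable f E k F\<^sub>0 (F(i := insert e (F i - {e'})))"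

lemma forest_packing_update:
  assumes "forest_packing f E k F" "i < k" "e \<in> E - (\<Union>j<k. F j)"
    "X \<subseteq> F i" "f e \<notin> conn f X"
  shows "forest_packing f E k (F(i := insert e X))"
proof -
  have "edge_forest f (insert e X)"
    using assms by (intro edge_forest_insert) (auto simp: forest_packing_def intro: edge_forest_subset)
  then show ?thesis
    using assms unfolding forest_packing_def disjoint_family_on_def
    by auto (metis IntI empty_iff lessThan_iff subsetD)+
qed

text \<open>One equation for both exchanges (\<open>X = {e'}\<close>) and plain insertions
  (\<open>X = {}\<close>).\<close>

lemma UN_fun_upd:
  fixes F :: "nat \<Rightarrow> 'e set"
  assumes "disjoint_family_on F {..<k}" "i < k" "X \<subseteq> F i"
  shows "(\<Union>j<k. (F(i := insert e (F i - X))) j) = insert e ((\<Union>j<k. F j) - X)"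
proof -
  have "F j \<inter> X = {}" if "j < k" "j \<noteq> i" for j
    using assms that by (auto simp: disjoint_family_on_def)
  then show ?thesis
    using assms(2) by (auto split: if_splits)
qed

lemma exchange_reachable_packing:
  assumes "exchange_reachable f E k F\<^sub>0 F" "forest_packing f E k F\<^sub>0" "finite E"
  shows "forest_packing f E k F \<and> card (\<Union>i<k. F i) = card (\<Union>i<k. F\<^sub>0 i)"
  using assms
proof (induction rule: exchange_reachable.induct)
  case (step F i e e')
  then have F: "forest_packing f E k F"
    by simp
  then have "(\<Union>j<k. F j) \<subseteq> E"
    by (auto simp: forest_packing_def)
  then have fin: "finite (\<Union>j<k. F j)"
    using step by (auto intro: finite_subset)
  have e': "e' \<in> (\<Union>j<k. F j)"
    using step by auto
  have "card (\<Union>j<k. (F(i := insert e (F i - {e'}))) j) = card (insert e ((\<Union>j<k. F j) - {e'}))"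
    using F step by (subst UN_fun_upd) (auto simp: forest_packing_def)
  also have "\<dots> = card (\<Union>j<k. F j)"
    using fin e' step card_Suc_Diff1[OF fin e'] by simp
  finally show ?case
    using forest_packing_update[OF F, of i e "F i - {e'}"] step
    by (simp del: fun_upd_apply)
qed auto

theorem maximum_forest_packing_closed_set:
  assumes "finite E"
  shows "\<exists>F R. forest_packing f E k F \<and> R \<subseteq> E \<and> E - (\<Union>i<k. F i) \<subseteq> R \<and>
    (\<forall>i<k. conn f (F i \<inter> R) = conn f R)"
proof -
  obtain F\<^sub>0 where "forest_packing f E k F\<^sub>0 \<and>
      (\<forall>F. forest_packing f E k F \<longrightarrow> card (\<Union>i<k. F i) \<le> card (\<Union>i<k. F\<^sub>0 i))"
    using ex_maximum_forest_packing[OF assms, of f k] by (rule exE)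
  then have F\<^sub>0: "forest_packing f E k F\<^sub>0"
    and max: "\<And>F. forest_packing f E k F \<Longrightarrow> card (\<Union>i<k. F i) \<le> card (\<Union>i<k. F\<^sub>0 i)"
    by simp_all
  let ?reach = "exchange_reachable f E k F\<^sub>0"
  define R where "R = {e. \<exists>F. ?reach F \<and> e \<in> E - (\<Union>i<k. F i)}"
  have packing: "forest_packing f E k F" if "?reach F" for F
    using exchange_reachable_packing[OF that F\<^sub>0 assms] by simp
  \<comment> \<open>Otherwise adding \<open>e\<close> to \<open>F i\<close> beats the maximum, since
    reachable packings cover as many edges as \<open>F\<^sub>0\<close>.\<close>
  have spanned: "f e \<in> conn f (F i)"
    if F: "?reach F" and e: "e \<in> E - (\<Union>j<k. F j)" and i: "i < k" for F e i
  proof (rule ccontr)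
    assume "f e \<notin> conn f (F i)"
    then have "forest_packing f E k (F(i := insert e (F i)))"
      using packing[OF F] i e by (intro forest_packing_update) auto
    then have "card (\<Union>j<k. (F(i := insert e (F i))) j) \<le> card (\<Union>j<k. F j)"
      using max exchange_reachable_packing[OF F F\<^sub>0 assms] by metis
    moreover have "(\<Union>j<k. (F(i := insert e (F i))) j) = insert e (\<Union>j<k. F j)"
      using UN_fun_upd[of F k i "{}" e] packing[OF F] i by (simp add: forest_packing_def)
    moreover have "finite (\<Union>j<k. F j)"
      using packing[OF F] assms by (auto simp: forest_packing_def intro: finite_subset)
    ultimately show False
      using e by simp
  qed
  \<comment> \<open>Swapping a circuit edge \<open>e'\<close> for \<open>e\<close> leaves
    \<open>e'\<close> uncovered in a reachable packing, so the whole circuit lies in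
    \<open>R\<close>.\<close>
  have spanned_R: "f e \<in> conn f (F i \<inter> R)"
    if F: "?reach F" and e: "e \<in> E - (\<Union>j<k. F j)" and i: "i < k" for F e i
  proof -
    let ?C = "{e' \<in> F i. f e \<notin> conn f (F i - {e'})}"
    have Fi: "edge_forest f (F i)" "F i \<subseteq> E"
      using packing[OF F] i by (auto simp: forest_packing_def)
    have "?C \<subseteq> R"
    proof
      fix e' assume e': "e' \<in> ?C"
      let ?F' = "F(i := insert e (F i - {e'}))"
      have "?reach ?F'"
        using e' e i F spanned[OF F e i] by (intro exchange_reachable.step) auto
      moreover have "(\<Union>j<k. ?F' j) = insert e ((\<Union>j<k. F j) - {e'})"
        using e' i packing[OF F] by (intro UN_fun_upd) (auto simp: forest_packing_def)
      then have "e' \<in> E - (\<Union>j<k. ?F' j)"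
        using e e' i Fi by auto
      ultimately show "e' \<in> R"
        unfolding R_def by blast
    qed
    then have "conn f ?C \<subseteq> conn f (F i \<inter> R)"
      by (intro conn_mono) auto
    then show ?thesis
      using edge_forest_circuit[OF Fi(1) finite_subset[OF Fi(2) assms] spanned[OF F e i]] by blast
  qed
  have invariant: "conn f (F i \<inter> R) = conn f (F\<^sub>0 i \<inter> R)" if "?reach F" "i < k" for F i
    using that(1)
  proof (induction rule: exchange_reachable.induct)
    case (step F j e e')
    show ?case
    proof (cases "i = j")
      case True
      let ?X = "F i \<inter> R - {e'}"
      have e: "f e \<in> conn f (F i \<inter> R)" "e \<in> R"
        using spanned_R[of F e i] step.hyps that(2) unfolding R_def by blast+
      then have new: "(F(j := insert e (F j - {e'}))) i \<inter> R = insert e ?X"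
        using True by auto
      have "conn f (insert e ?X) = conn f (F i \<inter> R)"
      proof
        show "conn f (insert e ?X) \<subseteq> conn f (F i \<inter> R)"
          using e(1) conn_superset[of _ "F i \<inter> R" f] by (intro conn_subset_conn image_subsetI) blast
        \<comment> \<open>An \<open>e'\<close> outside \<open>R\<close> is not removed from
          \<open>F i \<inter> R\<close>, so only this case calls for exchange.\<close>
        have "f e' \<in> conn f (insert e ?X)" if "e' \<in> R"
        proof (rule conn_exchange)
          show "f e \<in> conn f (insert e' ?X)"
            using e step that True by (auto simp: insert_absorb)
          show "f e \<notin> conn f ?X"
            using step True conn_mono[of ?X "F i - {e'}" f] by auto
        qed
        then show "conn f (F i \<inter> R) \<subseteq> conn f (insert e ?X)"
          by (intro conn_subset_conn image_subsetI) (metis DiffI IntD2 conn_superset insertCI singletonD)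
      qed
      then show ?thesis
        using new step by simp
    qed (use step in simp)
  qed simp
  \<comment> \<open>An edge of \<open>R\<close> is spanned within the reachable packing that misses
    it; the invariant carries this back to \<open>F\<^sub>0\<close>.\<close>
  have "conn f R \<subseteq> conn f (F\<^sub>0 i \<inter> R)" if "i < k" for i
  proof (rule conn_subset_conn, rule image_subsetI)
    fix e assume "e \<in> R"
    then obtain F where "?reach F" "e \<in> E - (\<Union>j<k. F j)"
      unfolding R_def by blast
    then show "f e \<in> conn f (F\<^sub>0 i \<inter> R)"
      using spanned_R[of F e i] invariant[of F i] that by simp
  qed
  then have conn: "conn f (F\<^sub>0 i \<inter> R) = conn f R" if "i < k" for i
    using conn_mono[of "F\<^sub>0 i \<inter> R" R f] that by blast
  have R: "R \<subseteq> E" "E - (\<Union>i<k. F\<^sub>0 i) \<subseteq> R"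
    using exchange_reachable.base[of f E k F\<^sub>0] unfolding R_def by blast+
  show ?thesis
    using F\<^sub>0 R conn by (intro exI[of _ F\<^sub>0] exI[of _ R]) simp
qed

section \<open>Partitions, crossing edges and the tree packing theorem\<close>

lemma conn_quotient_partition:
  assumes "f ` X \<subseteq> V \<times> V"
  shows "partition_on V (V // conn f X)"
proof (rule partition_onI)
  have "equiv UNIV (V \<times> V \<union> Id)"
    by (rule equivI) (auto simp: refl_on_def sym_def trans_def)
  then have "conn f X \<subseteq> V \<times> V \<union> Id"
    using assms by (intro conn_least) auto
  then show "\<Union> (V // conn f X) = V"
    by (auto simp: quotient_def)
next
  fix C D assume "C \<in> V // conn f X" "D \<in> V // conn f X" "C \<noteq> D"
  then show "disjnt C D"
    using quotient_disj[OF equiv_conn[of f X], of C D] by (auto simp: quotient_def disjnt_def)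
next
  show "{} \<notin> V // conn f X"
    by (auto simp: quotient_def)
qed

definition crossing_edges :: "('e \<Rightarrow> 'v \<times> 'v) \<Rightarrow> 'e set \<Rightarrow> 'v set set \<Rightarrow> 'e set" where
  "crossing_edges f E P = {e \<in> E. \<not> (\<exists>A \<in> P. fst (f e) \<in> A \<and> snd (f e) \<in> A)}"

theorem tutte_nash_williams:
  assumes "finite V" "V \<noteq> {}" "finite E" "f ` E \<subseteq> V \<times> V"
    and crossing: "\<And>P. partition_on V P \<Longrightarrow> k * (card P - 1) \<le> card (crossing_edges f E P)"
  shows "\<exists>T. (\<forall>i<k. T i \<subseteq> E \<and> V \<times> V \<subseteq> conn f (T i)) \<and> disjoint_family_on T {..<k}"
proof -
  obtain F R where "forest_packing f E k F \<and> R \<subseteq> E \<and> E - (\<Union>i<k. F i) \<subseteq> R \<and>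
      (\<forall>i<k. conn f (F i \<inter> R) = conn f R)"
    using maximum_forest_packing_closed_set[OF assms(3), of f k] by (elim exE)
  then have F: "forest_packing f E k F" and R: "R \<subseteq> E" "E - (\<Union>i<k. F i) \<subseteq> R"
    and conn: "\<And>i. i < k \<Longrightarrow> conn f (F i \<inter> R) = conn f R"
    by simp_all
  have FE: "F i \<subseteq> E" "edge_forest f (F i)" "finite (F i)" if "i < k" for i
    using F that assms(3) by (auto simp: forest_packing_def intro: finite_subset)
  let ?P = "V // conn f R"
  have "crossing_edges f E ?P \<subseteq> E - R"
  proof
    fix e assume e: "e \<in> crossing_edges f E ?P"
    have "e \<notin> R"
    proof
      assume "e \<in> R"
      then have "(fst (f e), snd (f e)) \<in> conn f R"
        using conn_superset[of e R f] by simp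
      moreover have "fst (f e) \<in> V"
        using e assms(4) by (auto simp: crossing_edges_def)
      ultimately show False
        using e by (auto simp: crossing_edges_def quotient_def)
    qed
    then show "e \<in> E - R"
      using e by (simp add: crossing_edges_def)
  qed
  then have "card (crossing_edges f E ?P) \<le> card (E - R)"
    using assms(3) by (intro card_mono) auto
  moreover have "partition_on V ?P"
    using R(1) assms(4) by (intro conn_quotient_partition) blast
  ultimately have "k * (card ?P - 1) \<le> card (E - R)"
    using crossing[of ?P] by linarith
  also have "E - R = (\<Union>i<k. F i - R)"
    using R(2) FE(1) by blast
  also have "card \<dots> = (\<Sum>i<k. card (F i - R))"
    using F FE by (intro card_UN_disjoint) (auto simp: forest_packing_def disjoint_family_on_def)
  finally have lower: "k * (card ?P - 1) \<le> (\<Sum>i<k. card (F i - R))" .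
  \<comment> \<open>The difference of the forest counts for \<open>F i\<close> and
    \<open>F i \<inter> R\<close>, the latter having the components of \<open>R\<close>.\<close>
  have split: "card (F i - R) + card (V // conn f (F i)) = card ?P" if i: "i < k" for i
  proof -
    have "card (F i) = card (F i \<inter> R) + card (F i - R)"
      using FE(3)[OF i] by (rule card_Int_Diff)
    moreover have "card (V // conn f (F i)) + card (F i) = card V"
      using FE[OF i] assms by (intro card_forest) auto
    moreover have "card (V // conn f (F i \<inter> R)) + card (F i \<inter> R) = card V"
      using FE[OF i] assms by (intro card_forest) (auto intro: edge_forest_subset)
    ultimately show ?thesis
      using conn[OF i] by simp
  qed
  have pos: "card (V // conn f X) > 0" for X
    using assms(1,2) by (auto simp: card_gt_0_iff quotient_def)
  have upper: "card (F i - R) \<le> card ?P - 1" if "i < k" for i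
    using split[OF that] pos[of "F i"] by linarith
  \<comment> \<open>The lower bound on the sum meets the termwise upper bounds, so each is tight,
    and \<open>split\<close> then leaves \<open>F i\<close> a single component.\<close>
  have "(\<Sum>i<k. card (F i - R)) \<le> (\<Sum>i<k. card ?P - 1)"
    using upper by (intro sum_mono) auto
  then have "(\<Sum>i<k. card (F i - R)) = (\<Sum>i<k. card ?P - 1)"
    using lower by simp
  then have eq: "card (F i - R) = card ?P - 1" if "i < k" for i
    by (rule sum_mono_inv[where I = "{..<k}"]) (use upper that in simp_all)
  have "V \<times> V \<subseteq> conn f (F i)" if i: "i < k" for i
  proof -
    have "card (V // conn f (F i)) = 1"
      using split[OF i] eq[OF i] pos[of R] by linarith
    then obtain C where C: "V // conn f (F i) = {C}"
      by (auto simp: card_1_singleton_iff)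
    have "conn f (F i) `` {v} = C" if "v \<in> V" for v
      using quotientI[OF that, of "conn f (F i)"] C by simp
    then have "(u, v) \<in> conn f (F i)" if "u \<in> V" "v \<in> V" for u v
      unfolding conn_iff_class[of u v] using that by simp
    then show ?thesis
      by auto
  qed
  then show ?thesis
    using F unfolding forest_packing_def by (intro exI[of _ F]) simp
qed

text \<open>At least \<open>2 * k\<close> edges leave each part of a nontrivial partition, and each
  crossing edge leaves two parts, so at least \<open>k * card P\<close> edges cross.\<close>

theorem edge_connected_tree_packing:
  assumes "finite V" "V \<noteq> {}" "finite E" "f ` E \<subseteq> V \<times> V"
    and cut: "\<And>S. S \<subset> V \<Longrightarrow> S \<noteq> {} \<Longrightarrow>
      2 * k \<le> card {e \<in> E. (fst (f e) \<in> S) \<noteq> (snd (f e) \<in> S)}"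
  shows "\<exists>T. (\<forall>i<k. T i \<subseteq> E \<and> V \<times> V \<subseteq> conn f (T i)) \<and> disjoint_family_on T {..<k}"
proof (rule tutte_nash_williams[OF assms(1-4)])
  fix P assume P: "partition_on V P"
  show "k * (card P - 1) \<le> card (crossing_edges f E P)"
  \<comment> \<open>With at most one part, truncated subtraction makes the bound \<open>0\<close>;
    with more, every part is a proper subset and the cut hypothesis applies.\<close>
  proof (cases "card P \<le> 1")
    case False
    have finP: "finite P"
      using finite_elements[OF assms(1) P] .
    have uniq: "A = B" if "A \<in> P" "B \<in> P" "x \<in> A" "x \<in> B" for A B x
      using partition_onD2[OF P] that by (auto simp: disjoint_def)
    have proper: "A \<subset> V" "A \<noteq> {}" if A: "A \<in> P" for A
    proof -
      show "A \<noteq> {}"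
        using partition_onD3[OF P] A by blast
      have "A \<subseteq> V"
        using partition_onD1[OF P] A by blast
      moreover have "A \<noteq> V"
      proof
        assume "A = V"
        have "B = A" if B: "B \<in> P" for B
        proof -
          obtain x where "x \<in> B"
            using partition_onD3[OF P] B by (metis ex_in_conv)
          moreover have "B \<subseteq> V"
            using partition_onD1[OF P] B by blast
          ultimately show ?thesis
            using uniq[OF B A, of x] \<open>A = V\<close> by auto
        qed
        then have "P \<subseteq> {A}"
          by blast
        then show False
          using False card_mono[of "{A}" P] by simp
      qed
      ultimately show "A \<subset> V" by blast
    qed
    let ?cut = "\<lambda>A e. (fst (f e) \<in> A) \<noteq> (snd (f e) \<in> A)"
    have "2 * k * card P = (\<Sum>A\<in>P. 2 * k)"
      by simp
    also have "\<dots> \<le> (\<Sum>A\<in>P. card {e \<in> E. ?cut A e})"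
      using cut proper by (intro sum_mono) blast
    also have "\<dots> = (\<Sum>e\<in>E. card {A \<in> P. ?cut A e})"
      using sum_multicount_gen[OF finP assms(3), of ?cut] by simp
    also have "\<dots> \<le> (\<Sum>e\<in>E. if e \<in> crossing_edges f E P then 2 else 0)"
    proof (rule sum_mono)
      fix e assume e: "e \<in> E"
      then have "f e \<in> V \<times> V"
        using assms(4) by blast
      then have "fst (f e) \<in> \<Union>P" "snd (f e) \<in> \<Union>P"
        unfolding partition_onD1[OF P] by (simp_all add: mem_Times_iff)
      then obtain A B where AB: "A \<in> P" "fst (f e) \<in> A" "B \<in> P" "snd (f e) \<in> B"
        by blast
      have end_class: "fst (f e) \<in> C \<longleftrightarrow> C = A" "snd (f e) \<in> C \<longleftrightarrow> C = B" if "C \<in> P" for C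
        using uniq[OF that AB(1) _ AB(2)] uniq[OF that AB(3) _ AB(4)] AB by auto
      then have sub: "{C \<in> P. ?cut C e} \<subseteq> {A, B}"
        by auto
      show "card {C \<in> P. ?cut C e} \<le> (if e \<in> crossing_edges f E P then 2 else 0)"
      proof (cases "A = B")
        case True
        then have "{C \<in> P. ?cut C e} = {}"
          using end_class by auto
        then show ?thesis
          by (simp only: card.empty)
      next
        case False
        then have "e \<in> crossing_edges f E P"
          using end_class e by (auto simp: crossing_edges_def)
        then show ?thesis
          using card_mono[OF _ sub] card_insert_le_m1[of 2 "{B}" A] by simp
      qed
    qed
    also have "\<dots> = 2 * card (crossing_edges f E P)"
      using assms(3) by (simp add: sum.If_cases crossing_edges_def Collect_conj_eq Int_commute)
    finally have "k * card P \<le> card (crossing_edges f E P)"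
      by simp
    then show ?thesis
      by (meson diff_le_self le_trans mult_le_mono2)
  qed simp
qed

section \<open>The bipartite representation of a digraph\<close>

definition bip :: "('a, 'b) pre_digraph \<Rightarrow> 'b \<Rightarrow> ('a + 'a) \<times> ('a + 'a)" where
  "bip G a = (Inl (tail G a), Inr (head G a))"

text \<open>
  Contrapositive form. The next step decides the current copy of \<open>x\<close>, which makes the statement
  inductive.
\<close>

lemma forward_trail_crosses_cut:
  assumes "underlying_walk G x p y" "successively (\<noteq>) (map snd p)" "p \<noteq> []" "snd (last p) = Forward"
    and "\<And>a. a \<in> steps_arcs p \<Longrightarrow> fst (bip G a) \<in> S \<longleftrightarrow> snd (bip G a) \<in> S"
  shows "(if snd (hd p) = Forward then Inl x else Inr x) \<in> S \<longleftrightarrow> Inr y \<in> S"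
  using assms
proof (induction p arbitrary: x)
  case (Cons s p)
  obtain a d where s: "s = (a, d)"
    by (cases s)
  have a: "Inl (tail G a) \<in> S \<longleftrightarrow> Inr (head G a) \<in> S"
    using Cons.prems(5)[of a] by (simp add: s steps_arcs_def bip_def)
  show ?case
  proof (cases p)
    case Nil
    then show ?thesis
      using Cons.prems a by (simp add: s step_from_def step_to_def)
  next
    case (Cons t q)
    have IH: "(if snd (hd p) = Forward then Inl (step_to G s) else Inr (step_to G s)) \<in> S \<longleftrightarrow> Inr y \<in> S"
      using Cons.prems Cons by (intro Cons.IH) (auto simp: steps_arcs_def)
    \<comment> \<open>By alternation \<open>s\<close> arrives in the very copy of its end vertex
      from which \<open>t\<close> departs.\<close>
    have "snd t \<noteq> d"
      using Cons.prems(2) Cons by (auto simp: s)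
    then show ?thesis
      using IH a Cons.prems(1) Cons
      by (cases d; cases "snd t") (auto simp: s step_from_def step_to_def)
  qed
qed simp

text \<open>Once \<open>S\<close> separates \<open>Inl x\<close> from \<open>Inr y\<close>, each of
  the \<open>m\<close> trails uses an arc across the cut, and disjointness makes these arcs
  distinct.\<close>

lemma arc_antistrong_cut:
  assumes "arc_antistrong m G" "finite (arcs G)"
    and S: "S \<subset> verts G <+> verts G" "S \<noteq> {}"
  shows "m \<le> card {a \<in> arcs G. (fst (bip G a) \<in> S) \<noteq> (snd (bip G a) \<in> S)}"
proof -
  let ?C = "{a \<in> arcs G. (fst (bip G a) \<in> S) \<noteq> (snd (bip G a) \<in> S)}"
  have three: "card (verts G) \<ge> 3"
    using assms(1) by (simp add: arc_antistrong_def)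
  have third: "\<exists>z \<in> verts G. z \<noteq> x \<and> z \<noteq> y" for x y
  proof (rule ccontr)
    assume "\<not> ?thesis"
    then have "verts G \<subseteq> {x, y}"
      by auto
    then have "card (verts G) \<le> card {x, y}"
      by (intro card_mono) auto
    also have "\<dots> \<le> 2"
      by (simp add: card_insert_if)
    finally show False
      using three by simp
  qed
  \<comment> \<open>Trails are given only for distinct vertices. If no such pair were separated, a
    third vertex would tie all copies together, making \<open>S\<close> empty or everything.\<close>
  have "\<exists>x \<in> verts G. \<exists>y \<in> verts G. x \<noteq> y \<and> (Inl x \<in> S) \<noteq> (Inr y \<in> S)"
  proof (rule ccontr)
    assume "\<not> ?thesis"
    then have same: "Inl x \<in> S \<longleftrightarrow> Inr y \<in> S" if "x \<in> verts G" "y \<in> verts G" "x \<noteq> y" for x y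
      using that by blast
    have l: "Inl x \<in> S \<longleftrightarrow> Inl x' \<in> S" if "x \<in> verts G" "x' \<in> verts G" for x x'
    proof -
      obtain z where "z \<in> verts G" "z \<noteq> x" "z \<noteq> x'"
        using third[of x x'] by blast
      then show ?thesis
        using same[of x z] same[of x' z] that by simp
    qed
    have r: "Inr y \<in> S \<longleftrightarrow> Inl x \<in> S" if "x \<in> verts G" "y \<in> verts G" for x y
    proof -
      obtain z where "z \<in> verts G" "z \<noteq> y"
        using third[of y y] by blast
      then show ?thesis
        using same[of z y] l[of x z] that by simp
    qed
    obtain x\<^sub>0 where x\<^sub>0: "x\<^sub>0 \<in> verts G"
      using third by blast
    have "u \<in> S \<longleftrightarrow> Inl x\<^sub>0 \<in> S" if "u \<in> verts G <+> verts G" for u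
      using that l[OF _ x\<^sub>0] r[OF x\<^sub>0] by auto
    then have "S = {} \<or> verts G <+> verts G \<subseteq> S"
      using S(1) by blast
    then show False
      using S by blast
  qed
  then obtain x y where xy: "x \<in> verts G" "y \<in> verts G" "x \<noteq> y" "(Inl x \<in> S) \<noteq> (Inr y \<in> S)"
    by blast
  have "\<exists>P. (\<forall>i<m. forward_antidirected_trail G x (P i) y) \<and>
      disjoint_family_on (\<lambda>i. steps_arcs (P i)) {..<m}"
    using assms(1) xy(1-3) unfolding arc_antistrong_def by simp
  then obtain P where "(\<forall>i<m. forward_antidirected_trail G x (P i) y) \<and>
      disjoint_family_on (\<lambda>i. steps_arcs (P i)) {..<m}"
    by (rule exE)
  then have P: "\<And>i. i < m \<Longrightarrow> forward_antidirected_trail G x (P i) y"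
    and disj: "disjoint_family_on (\<lambda>i. steps_arcs (P i)) {..<m}"
    by simp_all
  have walk_arcs: "steps_arcs p \<subseteq> arcs G" if "underlying_walk G u p v" for u p v
    using that by (induction p arbitrary: u) (auto simp: steps_arcs_def)
  define g where "g i = (SOME a. a \<in> steps_arcs (P i) \<inter> ?C)" for i
  have "\<exists>a. a \<in> steps_arcs (P i) \<inter> ?C" if "i < m" for i
  proof (rule ccontr)
    assume none: "\<not> ?thesis"
    have tr: "underlying_walk G x (P i) y" "successively (\<noteq>) (map snd (P i))" "P i \<noteq> []"
      "snd (hd (P i)) = Forward" "snd (last (P i)) = Forward"
      using P[OF that] by (auto simp: forward_antidirected_trail_def antidirected_trail_def)
    have "fst (bip G a) \<in> S \<longleftrightarrow> snd (bip G a) \<in> S" if "a \<in> steps_arcs (P i)" for a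
      using none that walk_arcs[OF tr(1)] by blast
    then have "Inl x \<in> S \<longleftrightarrow> Inr y \<in> S"
      using forward_trail_crosses_cut[OF tr(1-3) tr(5), of S] tr(4) by simp
    then show False
      using xy by blast
  qed
  then have g: "g i \<in> steps_arcs (P i) \<inter> ?C" if "i < m" for i
    unfolding g_def by (rule someI_ex) (fact that)
  have "inj_on g {..<m}"
  proof (rule inj_onI, rule ccontr)
    fix i j assume ij: "i \<in> {..<m}" "j \<in> {..<m}" "g i = g j" "i \<noteq> j"
    then have "g i \<in> steps_arcs (P i) \<inter> steps_arcs (P j)"
      using g[of i] g[of j] by simp
    then show False
      using disj ij unfolding disjoint_family_on_def by blast
  qed
  then have "card (g ` {..<m}) = m"
    by (simp add: card_image)
  moreover have "card (g ` {..<m}) \<le> card ?C"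
  proof (rule card_mono)
    show "finite ?C"
      using assms(2) by simp
    show "g ` {..<m} \<subseteq> ?C"
      using g by blast
  qed
  ultimately show ?thesis
    by simp
qed

section \<open>From bipartite connectivity back to antidirected trails\<close>

fun bip_from :: "('a, 'b) pre_digraph \<Rightarrow> 'b \<times> direction \<Rightarrow> 'a + 'a" where
  "bip_from G (a, Forward) = Inl (tail G a)"
| "bip_from G (a, Backward) = Inr (head G a)"

fun bip_to :: "('a, 'b) pre_digraph \<Rightarrow> 'b \<times> direction \<Rightarrow> 'a + 'a" where
  "bip_to G (a, Forward) = Inr (head G a)"
| "bip_to G (a, Backward) = Inl (tail G a)"

text \<open>Alternation is built in: forward steps lead from \<open>Inl\<close> to
  \<open>Inr\<close> and backward steps return, and the start at \<open>Inl x\<close> forces a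
  forward first step.\<close>

inductive bip_trail :: "('a, 'b) pre_digraph \<Rightarrow> 'a \<Rightarrow> 'b steps \<Rightarrow> 'a + 'a \<Rightarrow> bool" for G x where
  Nil: "bip_trail G x [] (Inl x)"
| snoc: "bip_trail G x p (bip_from G s) \<Longrightarrow> fst s \<in> arcs G \<Longrightarrow> fst s \<notin> steps_arcs p \<Longrightarrow>
    bip_trail G x (p @ [s]) (bip_to G s)"

inductive_cases bip_trail_snocE: "bip_trail G x (p @ [s]) v"

lemma bip_trail_prefix: "bip_trail G x (p @ q) v \<Longrightarrow> \<exists>u. bip_trail G x p u"
proof (induction q arbitrary: v rule: rev_induct)
  case (snoc s q)
  then have "bip_trail G x ((p @ q) @ [s]) v"
    by simp
  then show ?case
    by (rule bip_trail_snocE) (auto dest: snoc.IH)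
qed auto

text \<open>An arc that would be repeated already has both its ends on the trail, so a prefix suffices.\<close>

lemma bip_trail_extend:
  assumes "bip_trail G x p (bip_from G (a, d))" "a \<in> arcs G"
  shows "\<exists>q. bip_trail G x q (bip_to G (a, d))"
proof (cases "a \<in> steps_arcs p")
  case False
  then show ?thesis
    using assms bip_trail.snoc[of G x p "(a, d)"] by (intro exI) simp
next
  case True
  then obtain d' p1 p2 where p: "p = (p1 @ [(a, d')]) @ p2"
    by (fastforce simp: steps_arcs_def dest: split_list)
  then obtain v where v: "bip_trail G x (p1 @ [(a, d')]) v"
    using assms(1) bip_trail_prefix by metis
  then have "v = bip_to G (a, d')" "bip_trail G x p1 (bip_from G (a, d'))"
    by (auto elim: bip_trail_snocE)
  \<comment> \<open>If \<open>d' = d\<close>, the prefix through \<open>a\<close> ends at the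
    target; otherwise the prefix just before \<open>a\<close> does.\<close>
  then show ?thesis
    using v by (cases d; cases d') auto
qed

lemma bip_trail_ex:
  assumes "(Inl x, v) \<in> conn (bip G) (arcs G)"
  shows "\<exists>p. bip_trail G x p v"
  using assms unfolding conn_def
proof (induction rule: rtrancl_induct)
  case base
  show ?case
    by (rule exI[of _ "[]"]) (rule bip_trail.Nil)
next
  case (step u w)
  then obtain p a where p: "bip_trail G x p u" and a: "a \<in> arcs G" "(u, w) = bip G a \<or> (w, u) = bip G a"
    by auto
  then show ?case
    using bip_trail_extend[of G x p a Forward] bip_trail_extend[of G x p a Backward]
    by (auto simp: bip_def)
qed

lemma underlying_walk_snoc:
  assumes "underlying_walk G x p (step_from G s)" "fst s \<in> arcs G" "step_to G s \<in> verts G"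
  shows "underlying_walk G x (p @ [s]) (step_to G s)"
  using assms by (induction p arbitrary: x) auto

text \<open>The copy reached records the last direction: \<open>Inr\<close> after a forward step,
  \<open>Inl\<close> after a backward step or at the start. Reaching \<open>Inr y\<close> thus
  certifies a forward antidirected trail.\<close>

lemma bip_trail_antidirected:
  assumes "bip_trail G x p v" "wf_digraph G" "x \<in> verts G"
  shows "(\<exists>y. antidirected_trail G x p y \<and>
      v = (if p \<noteq> [] \<and> snd (last p) = Forward then Inr y else Inl y)) \<and>
    (p \<noteq> [] \<longrightarrow> snd (hd p) = Forward)"
  using assms
proof (induction rule: bip_trail.induct)
  case Nil
  then show ?case
    by (simp add: antidirected_trail_def)
next
  case (snoc p s)
  then obtain y where y: "antidirected_trail G x p y"
    "bip_from G s = (if p \<noteq> [] \<and> snd (last p) = Forward then Inr y else Inl y)"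
    and hd: "p \<noteq> [] \<longrightarrow> snd (hd p) = Forward"
    by auto
  obtain a d where s: "s = (a, d)"
    by (cases s)
  have yf: "y = step_from G s" and alt: "p \<noteq> [] \<Longrightarrow> snd (last p) \<noteq> d" and nil: "p = [] \<Longrightarrow> d = Forward"
    using y(2) s by (cases d; auto simp: step_from_def split: if_splits direction.splits)+
  have "step_to G s \<in> verts G"
    using snoc.hyps(2) snoc.prems(1) s
    by (cases d) (auto simp: step_to_def wf_digraph.head_in_verts wf_digraph.tail_in_verts)
  then have "underlying_walk G x (p @ [s]) (step_to G s)"
    using y(1) yf snoc.hyps(2) by (intro underlying_walk_snoc) (auto simp: antidirected_trail_def)
  then have "antidirected_trail G x (p @ [s]) (step_to G s)"
    using y(1) snoc.hyps(3) alt s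
    by (auto simp: antidirected_trail_def steps_arcs_def successively_append_iff last_map)
  moreover have "bip_to G s = (if d = Forward then Inr (step_to G s) else Inl (step_to G s))"
    using s by (cases d) (auto simp: step_to_def)
  moreover have "snd (hd (p @ [s])) = Forward"
    using hd nil s by (cases p) auto
  ultimately show ?case
    using s by auto
qed

lemma antistrong_if_bip_connected:
  assumes "wf_digraph G" "card (verts G) \<ge> 3"
    and "(verts G <+> verts G) \<times> (verts G <+> verts G) \<subseteq> conn (bip G) (arcs G)"
  shows "antistrong G"
  unfolding antistrong_def
proof (intro conjI ballI impI)
  fix x y assume x: "x \<in> verts G" and "y \<in> verts G"
  then have "(Inl x, Inr y) \<in> conn (bip G) (arcs G)"
    using assms(3) by auto
  then obtain p where "bip_trail G x p (Inr y)"
    using bip_trail_ex by metis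
  then have "forward_antidirected_trail G x p y"
    using bip_trail_antidirected[OF _ assms(1) x, of p "Inr y"]
    by (auto simp: forward_antidirected_trail_def split: if_splits)
  then show "\<exists>p. forward_antidirected_trail G x p y"
    by blast
qed (fact assms(2))

theorem theorem3p4:
  fixes D :: "('a, 'b) pre_digraph" and k :: nat
  assumes "fin_loopfree_digraph D"
    and "k \<ge> 1"
    and "arc_antistrong (2 * k) D"
  shows "\<exists>H :: nat \<Rightarrow> ('a, 'b) pre_digraph.
    (\<forall>i<k. spanning (H i) D \<and> antistrong (H i)) \<and>
    disjoint_family_on (\<lambda>i. arcs (H i)) {..<k}"
proof -
  interpret fin_loopfree_digraph D by fact
  let ?V = "verts D <+> verts D"
  have three: "card (verts D) \<ge> 3"
    using assms(3) by (simp add: arc_antistrong_def)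
  have "\<exists>T. (\<forall>i<k. T i \<subseteq> arcs D \<and> ?V \<times> ?V \<subseteq> conn (bip D) (T i)) \<and> disjoint_family_on T {..<k}"
  proof (rule edge_connected_tree_packing)
    show "finite ?V" "finite (arcs D)"
      by auto
    show "?V \<noteq> {}"
      using three by auto
    show "bip D ` arcs D \<subseteq> ?V \<times> ?V"
      by (auto simp: bip_def)
    show "2 * k \<le> card {a \<in> arcs D. (fst (bip D a) \<in> S) \<noteq> (snd (bip D a) \<in> S)}"
      if "S \<subset> ?V" "S \<noteq> {}" for S
      using arc_antistrong_cut[OF assms(3) finite_arcs that] .
  qed
  then obtain T where "(\<forall>i<k. T i \<subseteq> arcs D \<and> ?V \<times> ?V \<subseteq> conn (bip D) (T i)) \<and> disjoint_family_on T {..<k}"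
    by (rule exE)
  then have T: "\<And>i. i < k \<Longrightarrow> T i \<subseteq> arcs D" "disjoint_family_on T {..<k}"
    "\<And>i. i < k \<Longrightarrow> ?V \<times> ?V \<subseteq> conn (bip D) (T i)"
    by simp_all
  \<comment> \<open>Only the arc set changes, so \<open>bip (H i)\<close> is \<open>bip D\<close>
    and the connectivity of \<open>T i\<close> transfers to \<open>H i\<close>.\<close>
  define H where "H i = D\<lparr>arcs := T i\<rparr>" for i
  have H: "verts (H i) = verts D" "arcs (H i) = T i" "tail (H i) = tail D" "head (H i) = head D" for i
    by (simp_all add: H_def)
  have bip_H: "bip (H i) = bip D" for i
    by (simp add: bip_def fun_eq_iff H)
  have wf: "wf_digraph (H i)" if "i < k" for i
    using T(1)[OF that] by unfold_locales (auto simp: H subset_iff)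
  have "spanning (H i) D" if "i < k" for i
    using T(1)[OF that] wf[OF that] wf_digraph_axioms
    by (auto simp: spanning_def subgraph_def compatible_def H)
  moreover have "antistrong (H i)" if "i < k" for i
    using T(3)[OF that] three by (intro antistrong_if_bip_connected wf that) (auto simp: H bip_H)
  ultimately show ?thesis
    using T(2) by (intro exI[of _ H]) (simp add: H)
qed

end
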